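(* Let $3\le r\le 8$. For each ruling $f$ in the del Pezzo surface $S_r$, there is a pair of lines $l_1,l_2$ with $l_1\cdot l_2=1$ such that $f=l_1+l_2$ in $Pic\,S_r$. Furthermore, the set $F_r$ of rulings in $S_r$ is bijective to the set of $(r-1)$-crosspolytopes in the Gosset polytope $(r-4)_{21}$, and the Weyl group $W(S_r)$ acts transitively on $F_r$.
   Context: $S_r$ is a del Pezzo surface obtained by blowing up $\mathbb{P}^2$ at $r$ points in general position. $Pic\,S_r=\mathbb{Z}h\oplus\mathbb{Z}e_1\oplus\dots\oplus\mathbb{Z}e_r$ with $h^2=1$, $h\cdot e_i=0$, $e_i\cdot e_j=-\delta_{ij}$, and $K_{S_r}=-3h+\sum_{i=1}^r e_i$. Lines: $L_r=\{l\in Pic\,S_r\mid l^2=l\cdot K_{S_r}=-1\}$. Rulings: $F_r=\{f\in Pic\,S_r\mid f^2=0,\ K_{S_r}\cdot f=-2\}$. Roots: $R_r=\{d\in Pic\,S_r\mid d^2=-2,\ d\cdot K_{S_r}=0\}$; for $d\in R_r$, $\sigma_d(D)=D+(D\cdot d)d$. The Weyl group $W(S_r)$ (of type $E_r$) is generated by the $\sigma_d$ for the simple roots $d_0=h-e_1-e_2-e_3$, $d_i=e_i-e_{i+1}$ ($1\le i\le r-1$), and acts on $Pic\,S_r$ preserving the intersection form and $K_{S_r}$. The Gosset polytope $(r-4)_{21}$ is the $r$-dimensional semiregular polytope with symmetry group the Coxeter group $E_r$ ($E_3=A_1\times A_2$, $E_4=A_4$, $E_5=D_5$), realized as the convex hull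 of $L_r$ in $\{D\in Pic\,S_r\otimes\mathbb{Q}\mid -D\cdot K_{S_r}=1\}$ with the Euclidean metric given by minus the intersection form; its vertices are exactly the elements of $L_r$. Its facets are regular $(r-1)$-simplexes and $(r-1)$-crosspolytopes (an $n$-crosspolytope is the regular $n$-polytope with $2n$ vertices forming $n$ antipodal pairs; a $2$-crosspolytope is a square). *)

theory Defs
  imports "HOL-Analysis.Analysis" "HOL-Algebra.Generated_Groups" "HOL-Algebra.Group_Action"
begin

text \<open>
  The pair \<open>(a, x)\<close> stands for the divisor class \<open>a h + \<Sum>i. x $ i e\<^sub>i\<close>, where the
  index type \<^typ>\<open>'n\<close> labels the blown-up points, so that \<open>r = CARD('n)\<close>. Integer
  coordinates give the Picard group, real coordinates its scalar extension to the reals.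
\<close>

type_synonym ('a, 'n) cls = "'a \<times> ('a, 'n) vec"
type_synonym 'n pic = "(int, 'n) cls"

definition inter :: "('a::comm_ring_1, 'n::finite) cls \<Rightarrow> ('a, 'n) cls \<Rightarrow> 'a"  (infixl "\<bullet>\<^sub>S" 70)
  where "D \<bullet>\<^sub>S E = fst D * fst E - (\<Sum>i\<in>UNIV. snd D $ i * snd E $ i)"

definition scale_cls :: "'a::comm_ring_1 \<Rightarrow> ('a, 'n::finite) cls \<Rightarrow> ('a, 'n) cls"
  where "scale_cls k D = (k * fst D, k *s snd D)"

definition h_cls :: "'n::finite pic"
  where "h_cls = (1, 0)"

definition e_cls :: "'n \<Rightarrow> 'n::finite pic"
  where "e_cls i = (0, axis i 1)"

definition K_cls :: "'n::finite pic"
  where "K_cls = scale_cls (- 3) h_cls + (\<Sum>i\<in>UNIV. e_cls i)"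

definition lines :: "'n::finite pic set"
  where "lines = {l. l \<bullet>\<^sub>S l = - 1 \<and> l \<bullet>\<^sub>S K_cls = - 1}"

definition rulings :: "'n::finite pic set"
  where "rulings = {f. f \<bullet>\<^sub>S f = 0 \<and> K_cls \<bullet>\<^sub>S f = - 2}"

definition refl_cls :: "'n::finite pic \<Rightarrow> 'n pic \<Rightarrow> 'n pic"
  where "refl_cls d D = D + scale_cls (D \<bullet>\<^sub>S d) d"

text \<open>
  The simple roots depend on the order of the points; \<open>p 1, \<dots>, p r\<close> is an enumeration of the
  index type.
\<close>

definition simple_roots :: "(nat \<Rightarrow> 'n) \<Rightarrow> 'n::finite pic set"
  where "simple_roots p =
    insert (h_cls - e_cls (p 1) - e_cls (p 2) - e_cls (p 3))
      {e_cls (p i) - e_cls (p (i + 1)) | i. 1 \<le> i \<and> i \<le> CARD('n) - 1}"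

definition weyl_group :: "(nat \<Rightarrow> 'n) \<Rightarrow> ('n::finite pic \<Rightarrow> 'n pic) monoid"
  where "weyl_group p =
    (BijGroup UNIV)\<lparr>carrier := generate (BijGroup UNIV) (refl_cls ` simple_roots p)\<rparr>"

definition real_cls :: "'n::finite pic \<Rightarrow> (real, 'n) cls"
  where "real_cls D = (of_int (fst D), \<chi> i. of_int (snd D $ i))"

definition gosset_polytope :: "(real, 'n::finite) cls set"
  where "gosset_polytope = convex hull (real_cls ` lines)"

text \<open>
  The vertices of an \<open>n\<close>-crosspolytope are the intersections of an orthogonal frame of \<open>n\<close> lines
  through a centre \<open>c\<close> with a sphere around \<open>c\<close>. Lengths and angles are those of minus the
  intersection form, which is indefinite on the whole space; it is positive definite on the
  orthogonal complement of \<^term>\<open>K_cls\<close> (for at most 8 points), hence on the directions of the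
  hyperplane that contains \<^term>\<open>gosset_polytope\<close>. Convex hulls, faces and affine dimension do not
  depend on the choice of metric.
\<close>

definition crosspolytope :: "nat \<Rightarrow> (real, 'n::finite) cls set \<Rightarrow> bool"
  where "crosspolytope n P \<longleftrightarrow>
    (\<exists>c u \<rho>. \<rho> > 0 \<and>
      (\<forall>i<n. - (u i \<bullet>\<^sub>S u i) = \<rho>) \<and>
      (\<forall>i<n. \<forall>j<n. i \<noteq> j \<longrightarrow> u i \<bullet>\<^sub>S u j = 0) \<and>
      P = convex hull (\<Union>i<n. {c + u i, c - u i}))"

definition crosspolytope_facets :: "(real, 'n::finite) cls set set"
  where "crosspolytope_facets =
    {P. P facet_of gosset_polytope \<and> crosspolytope (CARD('n) - 1) P}"

end

theory Submission
  imports Defs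
begin

text \<open>
  Everything rests on two facts. The first is that the intersection form is negative definite on the
  orthogonal complement of \<open>K\<close> when there are at most 8 points
  (\<open>K_orthogonal_negative_definite\<close>); it gives the Hodge index inequality
  \<open>(9 - r) (D \<bullet> D) \<le> (D \<bullet> K)\<^sup>2\<close> (\<open>hodge_index\<close>), and from it that a ruling meets every line
  non-negatively (\<open>line_inter_ruling_nonneg\<close>). The second is that every ruling can be moved to
  \<open>h - e\<^sub>1\<close> by simple reflections. A ruling that is non-negative on all simple roots is \<open>h - e\<^sub>1\<close> by
  an elementary inequality (\<open>ruling_in_chamber\<close>), and any other ruling loses height under a suitable
  reflection (\<open>ruling_induct\<close>). Transitivity of the Weyl group follows at once. For \<open>h - e\<^sub>1\<close> the
  lines orthogonal to the ruling are visible, namely \<open>e\<^sub>i\<close> and \<open>h - e\<^sub>1 - e\<^sub>i\<close> for \<open>i \<noteq> 1\<close>, and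
  reflections carry this picture to every ruling \<open>f\<close>: there are \<open>r - 1\<close> mutually orthogonal pairs
  of lines, each pair with sum \<open>f\<close> and intersection number 1 (\<open>ruling_has_reducible_fibres\<close>).
  
  The crosspolytope of a ruling \<open>f\<close> is the convex hull of the lines orthogonal to \<open>f\<close>
  (\<open>ruling_face\<close>). Since \<open>f\<close> is non-negative on all lines, this is a face of the Gosset polytope;
  the pairs of lines exhibit it as an \<open>(r - 1)\<close>-crosspolytope with centre \<open>f / 2\<close>, and by dimension it
  is a facet (\<open>ruling_face_crosspolytope_facet\<close>). The facet determines \<open>f\<close>, because two rulings with
  the same facet are orthogonal to each other and then equal, again by definiteness.
  
  Conversely, antipodal vertices of a crosspolytope facet are lines whose sum is twice the
  centre. Integrality and the Hodge index inequality leave two values for the intersection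
  number of such a pair. It is 1, and the sum is a ruling with the given facet, or it is 3, which
  needs \<open>r = 8\<close> and puts the centre of the facet at \<open>- K\<close>. The latter point is the centre of symmetry
  of the whole polytope and lies on no facet (\<open>no_facet_contains_minus_K\<close>,
  \<open>crosspolytope_facet_is_ruling_face\<close>).
\<close>

section \<open>The intersection form\<close>

lemma inter_commute: "D \<bullet>\<^sub>S E = E \<bullet>\<^sub>S D"
  by (simp add: inter_def mult.commute)

lemma inter_add_left: "(D + E) \<bullet>\<^sub>S F = D \<bullet>\<^sub>S F + E \<bullet>\<^sub>S F"
  by (simp add: inter_def algebra_simps sum.distrib)

lemma inter_diff_left: "(D - E) \<bullet>\<^sub>S F = D \<bullet>\<^sub>S F - E \<bullet>\<^sub>S F"
  by (simp add: inter_def algebra_simps sum_subtractf)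

lemma inter_scale_left: "scale_cls k D \<bullet>\<^sub>S F = k * (D \<bullet>\<^sub>S F)"
  by (simp add: inter_def scale_cls_def algebra_simps sum_distrib_left)

lemma inter_minus_left: "(- D) \<bullet>\<^sub>S F = - (D \<bullet>\<^sub>S F)"
  by (simp add: inter_def sum_negf)

lemma inter_zero_left: "0 \<bullet>\<^sub>S F = 0"
  by (simp add: inter_def)

lemma inter_add_right: "F \<bullet>\<^sub>S (D + E) = F \<bullet>\<^sub>S D + F \<bullet>\<^sub>S E"
  by (metis inter_add_left inter_commute)

lemma inter_diff_right: "F \<bullet>\<^sub>S (D - E) = F \<bullet>\<^sub>S D - F \<bullet>\<^sub>S E"
  by (metis inter_diff_left inter_commute)

lemma inter_scale_right: "F \<bullet>\<^sub>S scale_cls k D = k * (F \<bullet>\<^sub>S D)"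
  by (metis inter_scale_left inter_commute)

lemma inter_minus_right: "F \<bullet>\<^sub>S (- D) = - (F \<bullet>\<^sub>S D)"
  by (metis inter_minus_left inter_commute)

lemma inter_zero_right: "F \<bullet>\<^sub>S 0 = 0"
  by (simp add: inter_def)

lemmas inter_linear =
  inter_add_left inter_diff_left inter_scale_left inter_minus_left inter_zero_left
  inter_add_right inter_diff_right inter_scale_right inter_minus_right inter_zero_right

lemma snd_e_cls: "snd (e_cls i) $ j = (if i = j then 1 else 0)"
  by (simp add: e_cls_def axis_def)

lemma inter_h: "h_cls \<bullet>\<^sub>S D = fst D"
  by (simp add: inter_def h_cls_def)

lemma inter_e: "e_cls i \<bullet>\<^sub>S D = - snd D $ i"
  by (simp add: inter_def snd_e_cls) (simp add: e_cls_def if_distrib[of "\<lambda>c. c * _"] cong: if_cong)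

lemma inter_K: "D \<bullet>\<^sub>S K_cls = - 3 * fst D - (\<Sum>i\<in>UNIV. snd D $ i)"
proof -
  have sum_left: "(\<Sum>i\<in>A. e_cls i) \<bullet>\<^sub>S D = (\<Sum>i\<in>A. e_cls i \<bullet>\<^sub>S D)" if "finite A" for A
    using that by (induction A rule: finite_induct) (simp_all add: inter_linear)
  have "K_cls \<bullet>\<^sub>S D = - 3 * fst D - (\<Sum>i\<in>UNIV. snd D $ i)"
    unfolding K_cls_def by (simp add: inter_linear sum_left inter_h inter_e sum_negf)
  then show ?thesis
    by (simp add: inter_commute)
qed

lemma fst_e_cls: "fst (e_cls i) = 0" and fst_h_cls: "fst h_cls = 1" and snd_h_cls: "snd h_cls = 0"
  by (simp_all add: e_cls_def h_cls_def)

lemma inter_e_e: "e_cls i \<bullet>\<^sub>S e_cls j = (if i = j then - 1 else 0)"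
  by (simp add: inter_e snd_e_cls)

lemma inter_h_e: "h_cls \<bullet>\<^sub>S e_cls i = 0" and inter_e_h: "e_cls i \<bullet>\<^sub>S h_cls = 0"
  and inter_h_h: "h_cls \<bullet>\<^sub>S h_cls = 1"
  by (simp_all add: inter_h inter_e fst_e_cls fst_h_cls snd_h_cls)

lemma inter_e_K: "e_cls i \<bullet>\<^sub>S K_cls = - 1" and inter_h_K: "h_cls \<bullet>\<^sub>S K_cls = - 3"
  by (simp_all add: inter_K fst_e_cls fst_h_cls snd_h_cls snd_e_cls)

lemma inter_K_K: "(K_cls :: 'n::finite pic) \<bullet>\<^sub>S K_cls = 9 - int CARD('n)"
proof -
  have f: "fst (K_cls :: 'n pic) = - 3"
    using inter_h[of K_cls] by (simp add: inter_h_K)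
  have s: "snd (K_cls :: 'n pic) $ i = 1" for i
    using inter_e[of i K_cls] by (simp add: inter_e_K)
  show ?thesis
    by (simp add: inter_K f s)
qed

lemmas inter_basis = inter_e_e inter_h_e inter_e_h inter_h_h inter_e_K inter_h_K

text \<open>
  If \<open>D = a h + \<Sum>i. x\<^sub>i e\<^sub>i\<close> is orthogonal to the canonical class, then \<open>\<Sum>i. x\<^sub>i = - 3 a\<close>, and
  the Cauchy-Schwarz inequality gives \<open>9 a\<^sup>2 \<le> r \<Sum>i. x\<^sub>i\<^sup>2\<close>. For \<open>r \<le> 8\<close> this contradicts
  \<open>\<Sum>i. x\<^sub>i\<^sup>2 \<le> a\<^sup>2\<close> unless everything vanishes. This is where the bound on the number of points
  comes from.
\<close>

lemma K_orthogonal_negative_definite: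
  fixes D :: "'n::finite pic"
  assumes "CARD('n) \<le> 8" and "D \<bullet>\<^sub>S K_cls = 0" and "0 \<le> D \<bullet>\<^sub>S D"
  shows "D = 0"
proof -
  define a q where "a = fst D" and "q = (\<Sum>i\<in>UNIV. (snd D $ i)\<^sup>2)"
  have "real_of_int ((\<Sum>i\<in>UNIV. snd D $ i)\<^sup>2) \<le> of_int (q * int CARD('n))"
    unfolding q_def using sum_squared_le_sum_of_squares[of "\<lambda>i. real_of_int (snd D $ i)" UNIV]
    by simp
  then have "(\<Sum>i\<in>UNIV. snd D $ i)\<^sup>2 \<le> q * int CARD('n)"
    by (simp only: of_int_le_iff)
  moreover have "(\<Sum>i\<in>UNIV. snd D $ i) = - 3 * a"
    using assms(2) unfolding inter_K a_def by simp
  ultimately have "9 * a\<^sup>2 \<le> q * int CARD('n)"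
    by (simp add: power_mult_distrib)
  also have "\<dots> \<le> q * 8"
    using assms(1) by (intro mult_left_mono) (auto simp: q_def sum_nonneg)
  finally have cs: "9 * a\<^sup>2 \<le> 8 * q"
    by simp
  have "q \<le> a\<^sup>2"
    using assms(3) by (simp add: inter_def a_def q_def power2_eq_square)
  with cs have "a\<^sup>2 = 0" "q \<le> 0"
    using zero_le_power2[of a] by linarith+
  moreover have "0 \<le> q"
    unfolding q_def by (intro sum_nonneg) simp
  ultimately have "a = 0" "q = 0"
    by auto
  then show ?thesis
    by (simp add: a_def q_def sum_nonneg_eq_0_iff prod_eq_iff vec_eq_iff)
qed

text \<open>
  With \<open>k = K \<bullet> K = 9 - r > 0\<close>, the class \<open>k D - (D \<bullet> K) K\<close> is the projection of \<open>k D\<close> to the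
  orthogonal complement of \<open>K\<close>, where the form is negative definite; its square is
  \<open>k (k (D \<bullet> D) - (D \<bullet> K)\<^sup>2)\<close>.
\<close>

lemma hodge_index:
  fixes D :: "'n::finite pic"
  assumes "CARD('n) \<le> 8"
  shows "(9 - int CARD('n)) * (D \<bullet>\<^sub>S D) \<le> (D \<bullet>\<^sub>S K_cls)\<^sup>2"
proof (rule ccontr)
  define k t where "k = 9 - int CARD('n)" and "t = D \<bullet>\<^sub>S K_cls"
  assume "\<not> ?thesis"
  then have gt: "t\<^sup>2 < k * (D \<bullet>\<^sub>S D)"
    by (simp add: k_def t_def)
  have "k > 0"
    using assms by (simp add: k_def)
  define E where "E = scale_cls k D - scale_cls t K_cls"
  have KK: "(K_cls :: 'n pic) \<bullet>\<^sub>S K_cls = k"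
    by (simp add: inter_K_K k_def)
  have EK: "E \<bullet>\<^sub>S K_cls = 0"
    by (simp add: E_def inter_linear KK t_def[symmetric] mult.commute)
  have "E \<bullet>\<^sub>S E = k * (k * (D \<bullet>\<^sub>S D) - t\<^sup>2)"
    by (simp add: E_def inter_linear KK t_def inter_commute[of K_cls D] algebra_simps power2_eq_square)
  then have "E \<bullet>\<^sub>S E > 0"
    using gt \<open>k > 0\<close> by simp
  moreover have "E = 0"
    using K_orthogonal_negative_definite[OF assms EK] calculation by simp
  ultimately show False
    by (simp add: inter_linear)
qed

section \<open>Lines and rulings\<close>

lemma lines_iff: "l \<in> lines \<longleftrightarrow> l \<bullet>\<^sub>S l = - 1 \<and> l \<bullet>\<^sub>S K_cls = - 1"
  by (simp add: lines_def)

lemma rulings_iff: "f \<in> rulings \<longleftrightarrow> f \<bullet>\<^sub>S f = 0 \<and> f \<bullet>\<^sub>S K_cls = - 2"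
  by (simp add: rulings_def inter_commute[of K_cls f])

lemma e_cls_line: "e_cls i \<in> lines"
  by (simp add: lines_iff inter_basis)

text \<open>
  Rulings are nef. If \<open>l \<bullet> f \<le> - 1\<close>, then \<open>2 f - 3 l\<close> has degree \<open>- 1\<close> against \<open>K\<close> but square at
  least 3, against the Hodge index inequality.
\<close>

lemma line_inter_ruling_nonneg:
  fixes f :: "'n::finite pic"
  assumes "CARD('n) \<le> 8" and "l \<in> lines" and "f \<in> rulings"
  shows "0 \<le> l \<bullet>\<^sub>S f"
proof (rule ccontr)
  define D where "D = scale_cls 2 f - scale_cls 3 l"
  assume "\<not> ?thesis"
  then have neg: "l \<bullet>\<^sub>S f \<le> - 1"
    by simp
  have "D \<bullet>\<^sub>S K_cls = - 1"
    using assms by (simp add: D_def inter_linear lines_iff rulings_iff)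
  moreover have "D \<bullet>\<^sub>S D = - 12 * (l \<bullet>\<^sub>S f) - 9"
    using assms by (simp add: D_def inter_linear lines_iff rulings_iff inter_commute[of f l])
  moreover have "(9 - int CARD('n)) * 3 \<le> (9 - int CARD('n)) * (- 12 * (l \<bullet>\<^sub>S f) - 9)"
    using neg assms(1) by (intro mult_left_mono) auto
  ultimately have "(9 - int CARD('n)) * 3 \<le> 1"
    using hodge_index[OF assms(1), of D] by simp
  then show False
    using assms(1) by simp
qed

text \<open>
  The difference of the two rulings is an isotropic vector orthogonal to \<open>K\<close>, hence zero.
\<close>

lemma rulings_orthogonal_imp_eq:
  fixes f :: "'n::finite pic"
  assumes "CARD('n) \<le> 8" and "f \<in> rulings" "g \<in> rulings" and "f \<bullet>\<^sub>S g = 0"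
  shows "f = g"
proof -
  have "f - g = 0"
    using assms
    by (intro K_orthogonal_negative_definite)
       (auto simp: inter_linear rulings_iff inter_commute[of g f])
  then show ?thesis
    by simp
qed

text \<open>
  A line with \<open>l \<bullet> f = 0\<close> is a component of a reducible fibre of the ruling, and the other
  component is again a line, meeting \<open>l\<close> once.
\<close>

lemma residual_line:
  assumes "l \<in> lines" and "f \<in> rulings" and "l \<bullet>\<^sub>S f = 0"
  shows "f - l \<in> lines" and "(f - l) \<bullet>\<^sub>S f = 0" and "l \<bullet>\<^sub>S (f - l) = 1"
  using assms by (auto simp: lines_iff rulings_iff inter_linear inter_commute[of f l])

section \<open>Reflections\<close>

definition is_root :: "'n::finite pic \<Rightarrow> bool"
  where "is_root d \<longleftrightarrow> d \<bullet>\<^sub>S d = - 2 \<and> d \<bullet>\<^sub>S K_cls = 0"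

lemma inter_refl_left: "refl_cls d D \<bullet>\<^sub>S E = D \<bullet>\<^sub>S E + (D \<bullet>\<^sub>S d) * (d \<bullet>\<^sub>S E)"
  by (simp add: refl_cls_def inter_linear)

lemma refl_cls_isometry:
  assumes "is_root d"
  shows "refl_cls d D \<bullet>\<^sub>S refl_cls d E = D \<bullet>\<^sub>S E"
  using assms
  by (simp add: is_root_def refl_cls_def inter_linear inter_commute[of d D] inter_commute[of d E] algebra_simps)

lemma refl_cls_inter_K:
  assumes "is_root d"
  shows "refl_cls d D \<bullet>\<^sub>S K_cls = D \<bullet>\<^sub>S K_cls"
  using assms by (simp add: is_root_def inter_refl_left)

lemma refl_cls_involution:
  assumes "is_root d"
  shows "refl_cls d (refl_cls d D) = D"
proof -
  have "refl_cls d D \<bullet>\<^sub>S d = - (D \<bullet>\<^sub>S d)"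
    using assms by (simp add: is_root_def inter_refl_left)
  then have "refl_cls d (refl_cls d D) = refl_cls d D + scale_cls (- (D \<bullet>\<^sub>S d)) d"
    by (simp add: refl_cls_def[of d "refl_cls d D"])
  then show ?thesis
    by (simp add: refl_cls_def scale_cls_def prod_eq_iff vec_eq_iff)
qed

lemma refl_cls_diff: "refl_cls d (D - E) = refl_cls d D - refl_cls d E"
  by (simp add: refl_cls_def inter_linear scale_cls_def prod_eq_iff vec_eq_iff algebra_simps)

lemma refl_cls_rulings:
  assumes "is_root d" "f \<in> rulings"
  shows "refl_cls d f \<in> rulings"
  using assms by (simp add: rulings_iff refl_cls_isometry refl_cls_inter_K)

lemma refl_cls_lines:
  assumes "is_root d" "l \<in> lines"
  shows "refl_cls d l \<in> lines"
  using assms by (simp add: lines_iff refl_cls_isometry refl_cls_inter_K)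

section \<open>Weyl group orbits of rulings\<close>

lemma simple_root_cases:
  fixes p :: "nat \<Rightarrow> 'n::finite"
  assumes "d \<in> simple_roots p"
  obtains "d = h_cls - e_cls (p 1) - e_cls (p 2) - e_cls (p 3)"
    | i where "1 \<le> i" "i < CARD('n)" "d = e_cls (p i) - e_cls (p (i + 1))"
proof -
  have "i < CARD('n)" if "i \<le> CARD('n) - 1" for i
    using that zero_less_card_finite[where 'a = 'n] by linarith
  then show ?thesis
    using assms that unfolding simple_roots_def by blast
qed

lemma simple_roots_are_roots:
  fixes p :: "nat \<Rightarrow> 'n::finite"
  assumes "3 \<le> CARD('n)" and "inj_on p {1..CARD('n)}" and "d \<in> simple_roots p"
  shows "is_root d"
  using assms(3)
proof (cases rule: simple_root_cases)
  case 1
  have "p 1 \<noteq> p 2" "p 1 \<noteq> p 3" "p 2 \<noteq> p 3"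
    using assms(1) by (auto dest!: inj_onD[OF assms(2)])
  then show ?thesis
    unfolding 1 is_root_def by (simp add: inter_linear inter_basis)
next
  case (2 i)
  have "p i \<noteq> p (i + 1)"
    using 2 by (auto dest!: inj_onD[OF assms(2)])
  then show ?thesis
    unfolding 2 is_root_def by (simp add: inter_linear inter_basis)
qed

text \<open>
  The arithmetic behind the reduction to the fundamental chamber. The numbers \<open>a\<close> and \<open>b\<close>, \<open>c\<close>, \<open>d\<close>
  are the degree and the three largest multiplicities of a ruling, and \<open>s\<close>, \<open>q\<close> are the sums of the
  other multiplicities and of their squares. Writing \<open>b = d + x\<close>, \<open>c = d + y\<close>,
  \<open>a = 3 d + x + y + w\<close> with non-negative \<open>x\<close>, \<open>y\<close>, \<open>w\<close>, the hypotheses bound a sum of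
  non-negative terms by zero.
\<close>

lemma chamber_inequality:
  fixes a b c d q s n :: int
  assumes "0 \<le> d" "d \<le> c" "c \<le> b" and "b + c + d \<le> a"
    and "0 \<le> s" "s \<le> n * d" and "q \<le> d * s"
    and "b + c + d + s = 3 * a - 2" and "b\<^sup>2 + c\<^sup>2 + d\<^sup>2 + q = a\<^sup>2"
  shows "a = 1 \<and> b = 1 \<and> c = 0 \<and> d = 0 \<and> s = 0"
proof -
  define x y w where "x = b - d" and "y = c - d" and "w = a - b - c - d"
  have nonneg: "0 \<le> x" "0 \<le> y" "0 \<le> w" "y \<le> x"
    using assms(1-4) by (simp_all add: x_def y_def w_def)
  have abc: "b = d + x" "c = d + y" "a = 3 * d + x + y + w"
    by (simp_all add: x_def y_def w_def)
  have s: "s = 3 * a - 2 - b - c - d"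
    using assms(8) by simp
  have "a\<^sup>2 \<le> b\<^sup>2 + c\<^sup>2 + d\<^sup>2 + d * (3 * a - 2 - b - c - d)"
    using assms(7,9) unfolding s by linarith
  then have "d * (2 * x + 2 * y + 3 * w) + 2 * (x * y) + 2 * (x * w) + 2 * (y * w) + w\<^sup>2 + 2 * d \<le> 0"
    unfolding abc by (simp add: power2_eq_square algebra_simps)
  moreover have "0 \<le> d * (2 * x + 2 * y + 3 * w)" "0 \<le> x * y" "0 \<le> x * w" "0 \<le> y * w" "0 \<le> w\<^sup>2"
    using nonneg assms(1) by auto
  ultimately have "d = 0" "x * y = 0" "w\<^sup>2 = 0"
    using assms(1) by linarith+
  moreover have "y = 0"
    using \<open>x * y = 0\<close> nonneg by auto
  ultimately show ?thesis
    using abc assms(5,6,8) by auto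
qed

text \<open>
  The coefficients of \<open>- e\<^sub>i\<close> in \<open>f\<close> are intersection numbers with lines, hence non-negative;
  the simple roots \<open>e\<^sub>i - e\<^sub>i\<^sub>+\<^sub>1\<close> make them decreasing and \<open>h - e\<^sub>1 - e\<^sub>2 - e\<^sub>3\<close> bounds the first
  three by the degree, so the previous inequality applies.
\<close>

lemma ruling_in_chamber:
  fixes p :: "nat \<Rightarrow> 'n::finite"
  assumes r: "3 \<le> CARD('n)" "CARD('n) \<le> 8" and p: "bij_betw p {1..CARD('n)} UNIV"
    and f: "f \<in> rulings" and chamber: "\<And>d. d \<in> simple_roots p \<Longrightarrow> 0 \<le> f \<bullet>\<^sub>S d"
  shows "f = h_cls - e_cls (p 1)"
proof -
  define r where "r = CARD('n)"
  define m where "m i = e_cls (p i) \<bullet>\<^sub>S f" for i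
  have snd_f: "snd f $ p i = - m i" for i
    by (simp add: m_def inter_e)
  have m_nonneg: "0 \<le> m i" for i
    unfolding m_def by (rule line_inter_ruling_nonneg[OF r(2) e_cls_line f])
  have descent: "m (Suc i) \<le> m i" if "1 \<le> i" "i < r" for i
  proof -
    have "e_cls (p i) - e_cls (p (i + 1)) \<in> simple_roots p"
      using that unfolding simple_roots_def r_def by fastforce
    from chamber[OF this] show ?thesis
      by (simp add: inter_linear m_def inter_commute[of f "e_cls _"])
  qed
  have "h_cls - e_cls (p 1) - e_cls (p 2) - e_cls (p 3) \<in> simple_roots p"
    by (simp add: simple_roots_def)
  from chamber[OF this] have top: "m 1 + m 2 + m 3 \<le> fst f"
    by (simp add: inter_linear m_def inter_commute[of f "e_cls _"] inter_commute[of f h_cls] inter_h)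
  have decreasing: "m i \<le> m 3" if "i \<in> {4..r}" for i
  proof -
    have "3 \<le> i" "i \<le> r" using that by auto
    then show ?thesis
    proof (induction i rule: dec_induct)
      case (step i)
      then show ?case
        using descent[of i] by simp
    qed simp
  qed
  have reindex: "(\<Sum>j\<in>UNIV. g j) = g (p 1) + g (p 2) + g (p 3) + (\<Sum>i=4..r. g (p i))" for g :: "'n \<Rightarrow> int"
  proof -
    have "(\<Sum>j\<in>UNIV. g j) = (\<Sum>i\<in>{1..r}. g (p i))"
      unfolding r_def by (rule sum.reindex_bij_betw[OF p, symmetric])
    also have "{1..r} = {1, 2, 3} \<union> {4..r}"
      using r by (auto simp: r_def)
    finally show ?thesis
      by (subst (asm) sum.union_disjoint) auto
  qed
  have "f \<bullet>\<^sub>S K_cls = - 2" "f \<bullet>\<^sub>S f = 0"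
    using f by (simp_all add: rulings_iff)
  then have sums: "m 1 + m 2 + m 3 + (\<Sum>i=4..r. m i) = 3 * fst f - 2"
      "(m 1)\<^sup>2 + (m 2)\<^sup>2 + (m 3)\<^sup>2 + (\<Sum>i=4..r. (m i)\<^sup>2) = (fst f)\<^sup>2"
    unfolding inter_K by (simp_all add: inter_def reindex snd_f sum_negf power2_eq_square)
  have tail: "(\<Sum>i=4..r. (m i)\<^sup>2) \<le> m 3 * (\<Sum>i=4..r. m i)"
    unfolding sum_distrib_left power2_eq_square
    by (intro sum_mono mult_right_mono decreasing m_nonneg)
  have "(\<Sum>i=4..r. m i) \<le> int (card {4..r}) * m 3"
    using sum_bounded_above[of "{4..r}" m "m 3"] decreasing by simp
  then have "fst f = 1 \<and> m 1 = 1 \<and> m 2 = 0 \<and> m 3 = 0 \<and> (\<Sum>i=4..r. m i) = 0"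
    using descent[of 1] descent[of 2] r top sums tail m_nonneg
    by (intro chamber_inequality[where n = "int (card {4..r})" and q = "\<Sum>i=4..r. (m i)\<^sup>2"])
       (simp_all add: r_def numeral_2_eq_2 numeral_3_eq_3 sum_nonneg)
  then have vals: "fst f = 1" "m 1 = 1" "m 2 = 0" "m 3 = 0" "\<And>i. i \<in> {4..r} \<Longrightarrow> m i = 0"
    by (simp_all add: sum_nonneg_eq_0_iff m_nonneg)
  have rest: "m i = 0" if "i \<in> {1..r}" "i \<noteq> 1" for i
  proof -
    have "i = 2 \<or> i = 3 \<or> i \<in> {4..r}" using that by auto
    then show ?thesis using vals by auto
  qed
  have "snd f $ j = - (if p 1 = j then 1 else 0)" for j
  proof -
    obtain i where i: "i \<in> {1..r}" "j = p i"
      using p unfolding r_def bij_betw_def by blast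
    have "p 1 = j \<longleftrightarrow> i = 1"
      using i r p by (auto simp: r_def bij_betw_def dest: inj_onD)
    then show ?thesis
      using i rest vals snd_f by auto
  qed
  then show ?thesis
    using vals by (simp add: prod_eq_iff vec_eq_iff fst_h_cls snd_h_cls fst_e_cls snd_e_cls)
qed

text \<open>
  The Weyl group moves every ruling to \<open>h - e\<^sub>1\<close>, in the form of an induction principle. The height
  \<open>f \<bullet> v\<close> is taken against a class \<open>v\<close> that is positive on the simple roots: a ruling that
  is negative on a simple root \<open>d\<close> loses height under the reflection in \<open>d\<close>, and a ruling that is
  negative on none is \<open>h - e\<^sub>1\<close>. The height is positive on all rulings, so this descent ends.
\<close>

lemma ruling_induct:
  fixes p :: "nat \<Rightarrow> 'n::finite"
  assumes r: "3 \<le> CARD('n)" "CARD('n) \<le> 8" and p: "bij_betw p {1..CARD('n)} UNIV"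
    and "f \<in> rulings"
    and base: "P (h_cls - e_cls (p 1))"
    and refl: "\<And>d f. d \<in> simple_roots p \<Longrightarrow> f \<in> rulings \<Longrightarrow> P f \<Longrightarrow> P (refl_cls d f)"
  shows "P f"
proof -
  define r where "r = CARD('n)"
  \<comment> \<open>The multiplicity of \<open>v\<close> at the \<open>i\<close>-th point is \<open>r - i\<close>. With these values \<open>v\<close> meets each
    \<open>e\<^sub>i - e\<^sub>i\<^sub>+\<^sub>1\<close> in 1, and the \<open>h\<close>-coefficient \<open>3 r\<close> makes \<open>v\<close> meet \<open>h - e\<^sub>1 - e\<^sub>2 - e\<^sub>3\<close> in 6.\<close>
  define M where "M j = int r - int (inv_into {1..r} p j)" for j
  define v :: "'n pic" where "v = (3 * int r, \<chi> j. - M j)"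
  have inj: "inj_on p {1..r}"
    using p by (simp add: r_def bij_betw_def)
  have root: "is_root d" if "d \<in> simple_roots p" for d
    using simple_roots_are_roots[OF r(1) _ that] inj by (simp add: r_def)
  have e_v: "e_cls (p i) \<bullet>\<^sub>S v = int r - int i" if "i \<in> {1..r}" for i
    using that inj by (simp add: inter_e v_def M_def)
  have root_v: "1 \<le> d \<bullet>\<^sub>S v" if "d \<in> simple_roots p" for d
    using that
  proof (cases rule: simple_root_cases)
    case 1
    have "h_cls \<bullet>\<^sub>S v = 3 * int r"
      by (simp add: inter_h v_def)
    then show ?thesis
      using 1 r e_v[of 1] e_v[of 2] e_v[of 3] by (simp add: inter_linear r_def)
  next
    case (2 i)
    then show ?thesis
      using e_v[of i] e_v[of "i + 1"] by (simp add: inter_linear r_def)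
  qed
  have pos: "0 < f \<bullet>\<^sub>S v" if f: "f \<in> rulings" for f
  proof -
    have nonneg: "snd f $ j \<le> 0" for j
      using line_inter_ruling_nonneg[OF r(2) e_cls_line f, of j] by (simp add: inter_e)
    \<comment> \<open>The multiplicities of \<open>f\<close> sum to \<open>3 a - 2\<close>, where \<open>a\<close> is the degree, so the height is at least
      \<open>3 r a - r (3 a - 2) = 2 r\<close>.\<close>
    have "M j \<le> int r" for j
      by (simp add: M_def)
    then have "int r * (\<Sum>j\<in>UNIV. snd f $ j) \<le> (\<Sum>j\<in>UNIV. snd f $ j * M j)"
      unfolding sum_distrib_left using nonneg
      by (intro sum_mono) (metis mult.commute mult_left_mono_neg)
    moreover have "f \<bullet>\<^sub>S K_cls = - 2"
      using f by (simp add: rulings_iff)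
    then have "3 * fst f + (\<Sum>j\<in>UNIV. snd f $ j) = 2"
      unfolding inter_K by simp
    then have "int r * (3 * fst f + (\<Sum>j\<in>UNIV. snd f $ j)) = int r * 2"
      by (rule arg_cong)
    then have "3 * int r * fst f + int r * (\<Sum>j\<in>UNIV. snd f $ j) = 2 * int r"
      unfolding distrib_left by (simp only: ac_simps)
    ultimately show ?thesis
      using r by (simp add: inter_def v_def sum_negf r_def algebra_simps)
  qed
  show ?thesis
    using \<open>f \<in> rulings\<close>
  proof (induction "nat (f \<bullet>\<^sub>S v)" arbitrary: f rule: less_induct)
    case less
    show ?case
    proof (cases "\<forall>d\<in>simple_roots p. 0 \<le> f \<bullet>\<^sub>S d")
      case True
      then show ?thesis
        using ruling_in_chamber[OF r p less.prems] base by simp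
    next
      case False
      then obtain d where d: "d \<in> simple_roots p" "f \<bullet>\<^sub>S d < 0"
        by force
      define f' where "f' = refl_cls d f"
      have f': "f' \<in> rulings"
        unfolding f'_def by (rule refl_cls_rulings[OF root[OF d(1)] less.prems])
      have "(f \<bullet>\<^sub>S d) * (d \<bullet>\<^sub>S v) < 0"
        using d(2) root_v[OF d(1)] by (intro mult_neg_pos) auto
      then have "f' \<bullet>\<^sub>S v < f \<bullet>\<^sub>S v"
        by (simp add: f'_def inter_refl_left)
      then have "nat (f' \<bullet>\<^sub>S v) < nat (f \<bullet>\<^sub>S v)"
        using pos[OF f'] by simp
      then have "P f'"
        using less.hyps f' by blast
      then have "P (refl_cls d f')"
        by (rule refl[OF d(1) f'])
      then show ?thesis
        by (simp add: f'_def refl_cls_involution[OF root[OF d(1)]])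
    qed
  qed
qed

section \<open>The Weyl group action\<close>

text \<open>
  Simple reflections are involutions, hence their own inverses as group generators, and they permute
  the rulings; this passes to all words in them. Every orbit contains \<open>h - e\<^sub>1\<close> by the induction
  principle for rulings.
\<close>

lemma weyl_group_transitive:
  fixes p :: "nat \<Rightarrow> 'n::finite"
  assumes r: "3 \<le> CARD('n)" "CARD('n) \<le> 8" and p: "bij_betw p {1..CARD('n)} UNIV"
  shows "transitive_action (weyl_group p) (rulings :: 'n pic set) (\<lambda>w. restrict w rulings)"
proof -
  define G where "G = BijGroup (UNIV :: 'n pic set)"
  define S where "S = refl_cls ` simple_roots p"
  define W where "W = generate G S"
  have weyl: "weyl_group p = G\<lparr>carrier := W\<rparr>"
    by (simp add: weyl_group_def G_def W_def S_def)
  interpret G: group G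
    unfolding G_def by (rule group_BijGroup)
  have carrier_G: "g \<in> carrier G \<longleftrightarrow> bij g" for g
    by (simp add: G_def BijGroup_def Bij_def)
  have mult_G: "g \<otimes>\<^bsub>G\<^esub> k = g \<circ> k" if "bij g" "bij k" for g k
    using that by (simp add: G_def BijGroup_def Bij_def compose_def fun_eq_iff)
  have one_G: "\<one>\<^bsub>G\<^esub> = id"
    by (rule ext) (simp add: G_def BijGroup_def)
  have root: "is_root d" if "d \<in> simple_roots p" for d
    using simple_roots_are_roots[OF r(1) _ that] p by (simp add: bij_betw_def)
  have refl_refl: "refl_cls d \<circ> refl_cls d = id" if "d \<in> simple_roots p" for d
    by (rule ext) (simp add: refl_cls_involution root that)
  have refl_bij: "bij (refl_cls d)" if "d \<in> simple_roots p" for d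
    by (rule o_bij[OF refl_refl refl_refl]) (rule that)+
  have S_carrier: "S \<subseteq> carrier G"
    by (auto simp: S_def carrier_G refl_bij)
  have inv_S: "inv\<^bsub>G\<^esub> s = s" if s: "s \<in> S" for s
  proof -
    obtain d where d: "d \<in> simple_roots p" "s = refl_cls d"
      using \<open>s \<in> S\<close> unfolding S_def by blast
    have "s \<otimes>\<^bsub>G\<^esub> s = \<one>\<^bsub>G\<^esub>"
      using d by (simp add: mult_G refl_bij one_G refl_refl)
    then show ?thesis
      using S_carrier s G.inv_equality by blast
  qed
  have W_sub: "subgroup W G"
    unfolding W_def by (rule G.generate_is_subgroup[OF S_carrier])
  have W_bij: "bij w" if "w \<in> W" for w
    using that subgroup.subset[OF W_sub] carrier_G by blast
  have refl_rulings: "s ` rulings = rulings" if "s \<in> S" for s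
  proof -
    obtain d where d: "d \<in> simple_roots p" "s = refl_cls d"
      using \<open>s \<in> S\<close> unfolding S_def by blast
    show ?thesis
      using d refl_cls_rulings[OF root[OF d(1)]] refl_cls_involution[OF root[OF d(1)]]
      by (auto intro!: image_eqI[where x = "refl_cls d _"])
  qed
  have W_rulings: "w ` rulings = rulings" if "w \<in> W" for w
    using that unfolding W_def
  proof (induction rule: generate.induct)
    case (eng w1 w2)
    then have "w1 \<otimes>\<^bsub>G\<^esub> w2 = w1 \<circ> w2"
      by (intro mult_G W_bij) (simp_all add: W_def)
    then show ?case
      using eng.IH by (simp only: image_comp[symmetric])
  qed (simp_all add: one_G inv_S refl_rulings)
  have W_Bij: "restrict w rulings \<in> Bij rulings" if "w \<in> W" for w
    using W_rulings[OF that] W_bij[OF that]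
    by (auto simp: Bij_def bij_betw_def intro: inj_on_subset)
  interpret weyl: group "weyl_group p"
    unfolding weyl by (rule G.subgroup_imp_group[OF W_sub])
  have hom: "restrict (w \<otimes>\<^bsub>weyl_group p\<^esub> w') rulings
      = restrict w rulings \<otimes>\<^bsub>BijGroup rulings\<^esub> restrict w' rulings" if "w \<in> W" "w' \<in> W" for w w'
  proof -
    have "w' f \<in> rulings" if "f \<in> rulings" for f
      using W_rulings[OF \<open>w' \<in> W\<close>] that by blast
    then show ?thesis
      using W_Bij that
      by (auto simp: weyl mult_G W_bij BijGroup_def compose_def fun_eq_iff)
  qed
  have action: "group_action (weyl_group p) (rulings :: 'n pic set) (\<lambda>w. restrict w rulings)"
  proof (unfold group_action_def group_hom_def group_hom_axioms_def, intro conjI)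
    show "(\<lambda>w. restrict w rulings) \<in> hom (weyl_group p) (BijGroup rulings)"
      by (rule homI) (use W_Bij hom in \<open>auto simp: weyl BijGroup_def\<close>)
  qed (rule weyl.group_axioms group_BijGroup)+
  define f0 where "f0 = (h_cls - e_cls (p 1) :: 'n pic)"
  have orbit: "\<exists>w\<in>W. w f0 = f" if "f \<in> rulings" for f
    using that
  proof (rule ruling_induct[OF r p])
    show "\<exists>w\<in>W. w f0 = h_cls - e_cls (p 1)"
      using subgroup.one_closed[OF W_sub] by (auto simp: f0_def one_G intro!: bexI[where x = id])
  next
    fix d f
    assume d: "d \<in> simple_roots p" and "\<exists>w\<in>W. w f0 = f"
    then obtain w where w: "w \<in> W" "w f0 = f"
      by blast
    have s: "refl_cls d \<in> W"
      using d by (auto simp: W_def S_def intro: generate.incl)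
    have "refl_cls d \<circ> w \<in> W"
      using subgroup.m_closed[OF W_sub s w(1)] by (simp add: mult_G W_bij s w(1))
    then show "\<exists>w\<in>W. w f0 = refl_cls d f"
      using w(2) by (auto intro!: bexI[where x = "refl_cls d \<circ> w"])
  qed
  show ?thesis
  proof (unfold transitive_action_def transitive_action_axioms_def, intro conjI allI impI)
    fix f g :: "'n pic"
    assume f: "f \<in> rulings" and g: "g \<in> rulings"
    obtain w w' where w: "w \<in> W" "w f0 = f" and w': "w' \<in> W" "w' f0 = g"
      using orbit f g by meson
    define x where "x = inv\<^bsub>G\<^esub> w"
    have x: "x \<in> W" "x \<circ> w = id"
      using subgroup.m_inv_closed[OF W_sub w(1)] G.l_inv[of w] subgroup.subset[OF W_sub] w(1)
      by (auto simp: x_def mult_G W_bij one_G)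
    have "x f = f0"
      using fun_cong[OF x(2), of f0] w(2) by simp
    moreover have "w' \<circ> x \<in> W"
      using subgroup.m_closed[OF W_sub w'(1) x(1)] by (simp add: mult_G W_bij w'(1) x(1))
    ultimately show "\<exists>w\<in>carrier (weyl_group p). restrict w rulings f = g"
      using w'(2) f by (auto simp: weyl intro!: bexI[where x = "w' \<circ> x"])
  qed (rule action)
qed

section \<open>The reducible fibres of a ruling\<close>

text \<open>
  The ruling \<open>f\<close> has \<open>r - 1\<close> reducible fibres \<open>L i + (f - L i)\<close>, and their components are all the
  lines in fibres of \<open>f\<close>. Components of different fibres are disjoint.
\<close>

definition reducible_fibres :: "'n::finite pic \<Rightarrow> (nat \<Rightarrow> 'n pic) \<Rightarrow> bool"
  where "reducible_fibres f L \<longleftrightarrow>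
    (\<forall>i<CARD('n) - 1. L i \<in> lines \<and> L i \<bullet>\<^sub>S f = 0) \<and>
    (\<forall>i<CARD('n) - 1. \<forall>j<CARD('n) - 1. i \<noteq> j \<longrightarrow> L i \<bullet>\<^sub>S L j = 0) \<and>
    (\<forall>l\<in>lines. l \<bullet>\<^sub>S f = 0 \<longrightarrow> (\<exists>i<CARD('n) - 1. l = L i \<or> l = f - L i))"

text \<open>
  The ruling \<open>h - e\<^sub>k\<close> is the pencil of plane lines through the \<open>k\<close>-th point, whose degenerate
  members pass through a second point. Orthogonality removes the \<open>k\<close>-th coefficient from
  \<open>l \<bullet> l = - 1\<close>, so exactly one other coefficient is non-zero and it is \<open>\<plusminus> 1\<close>; the degree then
  fixes \<open>l\<close>.
\<close>

lemma line_orthogonal_to_h_minus_e: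
  fixes l :: "'n::finite pic"
  assumes "l \<in> lines" and "l \<bullet>\<^sub>S (h_cls - e_cls k) = 0"
  obtains j where "j \<noteq> k" and "l = e_cls j \<or> l = h_cls - e_cls k - e_cls j"
proof -
  define a x where "a = fst l" and "x j = snd l $ j" for j
  have xk: "x k = - a"
    using assms(2)
    by (simp add: inter_linear inter_commute[of l h_cls] inter_commute[of l "e_cls k"] inter_h inter_e a_def x_def)
  have "l \<bullet>\<^sub>S l = - 1" "l \<bullet>\<^sub>S K_cls = - 1"
    using assms(1) by (simp_all add: lines_iff)
  then have sums: "(\<Sum>j\<in>UNIV. (x j)\<^sup>2) = a\<^sup>2 + 1" "3 * a + (\<Sum>j\<in>UNIV. x j) = 1"
    unfolding inter_K by (simp_all add: inter_def a_def x_def power2_eq_square)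
  have "(\<Sum>j\<in>UNIV. (x j)\<^sup>2) = (x k)\<^sup>2 + (\<Sum>j\<in>UNIV - {k}. (x j)\<^sup>2)"
    by (rule sum.remove) simp_all
  then have "(\<Sum>j\<in>UNIV - {k}. (x j)\<^sup>2) \<noteq> 0"
    using sums(1) by (simp add: xk)
  then obtain j where "j \<in> UNIV - {k}" "(x j)\<^sup>2 \<noteq> 0"
    by (rule sum.not_neutral_contains_not_neutral)
  then have j: "j \<noteq> k" "x j \<noteq> 0"
    by simp_all
  have split: "(\<Sum>i\<in>UNIV. g i) = g k + (g j + (\<Sum>i\<in>UNIV - {k} - {j}. g i))" for g :: "'n \<Rightarrow> int"
    using j(1) sum.remove[of UNIV k g] sum.remove[of "UNIV - {k}" j g] by simp
  have "(x j)\<^sup>2 + (\<Sum>i\<in>UNIV - {k} - {j}. (x i)\<^sup>2) = 1"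
    using sums(1) split[of "\<lambda>i. (x i)\<^sup>2"] by (simp add: xk)
  moreover have "0 < (x j)\<^sup>2" "0 \<le> (\<Sum>i\<in>UNIV - {k} - {j}. (x i)\<^sup>2)"
    using j(2) by (auto intro: sum_nonneg)
  ultimately have xj: "(x j)\<^sup>2 = 1" and "(\<Sum>i\<in>UNIV - {k} - {j}. (x i)\<^sup>2) = 0"
    by linarith+
  then have rest: "x i = 0" if "i \<noteq> k" "i \<noteq> j" for i
    using that by (simp add: sum_nonneg_eq_0_iff)
  note split[of x]
  also have "(\<Sum>i\<in>UNIV - {k} - {j}. x i) = 0"
    by (rule sum.neutral) (use rest in auto)
  finally have "2 * a + x j = 1"
    using sums(2) xk by simp
  moreover have "x j = 1 \<or> x j = - 1"
    using xj by (simp add: power2_eq_1_iff)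
  ultimately have "x j = 1 \<and> a = 0 \<or> x j = - 1 \<and> a = 1"
    by auto
  moreover have "snd l $ i = (if i = k then - a else if i = j then x j else 0)" for i
    using xk rest[of i] by (auto simp: x_def)
  ultimately have "l = e_cls j \<or> l = h_cls - e_cls k - e_cls j"
    using j(1) a_def
    by (auto simp: prod_eq_iff vec_eq_iff fst_e_cls snd_e_cls fst_h_cls snd_h_cls)
  with j(1) that show ?thesis
    by blast
qed

lemma reducible_fibres_h_minus_e:
  fixes p :: "nat \<Rightarrow> 'n::finite"
  assumes p: "bij_betw p {1..CARD('n)} UNIV"
  shows "reducible_fibres (h_cls - e_cls (p 1)) (\<lambda>i. e_cls (p (i + 2)))"
proof -
  have inj: "p i = p j \<longleftrightarrow> i = j" if "1 \<le> i" "i \<le> CARD('n)" "1 \<le> j" "j \<le> CARD('n)" for i j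
    using p that by (auto simp: bij_betw_def dest: inj_onD)
  have "\<exists>i<CARD('n) - 1. l = e_cls (p (i + 2)) \<or> l = h_cls - e_cls (p 1) - e_cls (p (i + 2))"
    if l: "l \<in> lines" "l \<bullet>\<^sub>S (h_cls - e_cls (p 1)) = 0" for l
  proof -
    obtain j where j: "j \<noteq> p 1" "l = e_cls j \<or> l = h_cls - e_cls (p 1) - e_cls j"
      using line_orthogonal_to_h_minus_e[OF l] by blast
    obtain i where i: "1 \<le> i" "i \<le> CARD('n)" "j = p i"
      using p unfolding bij_betw_def by (metis UNIV_I atLeastAtMost_iff imageE)
    then have "i \<noteq> 1"
      using j(1) by auto
    then have "i - 2 < CARD('n) - 1" "i - 2 + 2 = i"
      using i by auto
    then show ?thesis
      using i j(2) by metis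
  qed
  moreover have "e_cls (p (i + 2)) \<in> lines \<and> e_cls (p (i + 2)) \<bullet>\<^sub>S (h_cls - e_cls (p 1)) = 0"
    if "i < CARD('n) - 1" for i
    using that inj[of "i + 2" 1] by (simp add: e_cls_line inter_linear inter_basis)
  moreover have "e_cls (p (i + 2)) \<bullet>\<^sub>S e_cls (p (j + 2)) = 0"
    if "i < CARD('n) - 1" "j < CARD('n) - 1" "i \<noteq> j" for i j
    using that inj[of "i + 2" "j + 2"] by (simp add: inter_basis)
  ultimately show ?thesis
    unfolding reducible_fibres_def by blast
qed

text \<open>
  Reflections in roots preserve the intersection form and the set of lines, so they transport the
  reducible fibres of one ruling to those of its image.
\<close>

lemma reducible_fibres_refl:
  fixes f :: "'n::finite pic"
  assumes d: "is_root d" and L: "reducible_fibres f L"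
  shows "reducible_fibres (refl_cls d f) (\<lambda>i. refl_cls d (L i))"
proof -
  have "\<exists>i<CARD('n) - 1. l = refl_cls d (L i) \<or> l = refl_cls d f - refl_cls d (L i)"
    if l: "l \<in> lines" "l \<bullet>\<^sub>S refl_cls d f = 0" for l
  proof -
    have "refl_cls d l \<bullet>\<^sub>S f = 0"
      using l(2) refl_cls_isometry[OF d, of l "refl_cls d f"] by (simp add: refl_cls_involution[OF d])
    then obtain i where i: "i < CARD('n) - 1" "refl_cls d l = L i \<or> refl_cls d l = f - L i"
      using L refl_cls_lines[OF d l(1)] unfolding reducible_fibres_def by blast
    then show ?thesis
      by (metis refl_cls_diff refl_cls_involution[OF d])
  qed
  then show ?thesis
    using L unfolding reducible_fibres_def
    by (simp add: refl_cls_isometry[OF d] refl_cls_lines[OF d])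
qed

lemma ruling_has_reducible_fibres:
  fixes f :: "'n::finite pic" and p :: "nat \<Rightarrow> 'n"
  assumes r: "3 \<le> CARD('n)" "CARD('n) \<le> 8" and p: "bij_betw p {1..CARD('n)} UNIV"
    and "f \<in> rulings"
  shows "\<exists>L. reducible_fibres f L"
  using assms(4)
proof (rule ruling_induct[OF r p])
  show "\<exists>L. reducible_fibres (h_cls - e_cls (p 1)) L"
    using reducible_fibres_h_minus_e[OF p] by blast
  show "\<exists>L. reducible_fibres (refl_cls d f) L"
    if "d \<in> simple_roots p" "\<exists>L. reducible_fibres f L" for d f
    using that(2) reducible_fibres_refl[OF simple_roots_are_roots[OF r(1) bij_betw_imp_inj_on[OF p] that(1)]]
    by blast
qed

section \<open>Supporting hyperplanes and crosspolytopes\<close>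

text \<open>
  The union of the open half space and the convex hull of the generators on the hyperplane is
  already convex: a proper combination with a point of the open half space stays in it. Hence this
  union contains the convex hull of all generators, finitely many or not.
\<close>

lemma convex_hull_Int_supporting_hyperplane:
  fixes a :: "'a::euclidean_space"
  assumes "\<And>v. v \<in> V \<Longrightarrow> b \<le> a \<bullet> v"
  shows "convex hull {v \<in> V. a \<bullet> v = b} = convex hull V \<inter> {x. a \<bullet> x = b}"
proof
  define F where "F = convex hull {v \<in> V. a \<bullet> v = b}"
  have F_plane: "F \<subseteq> {x. a \<bullet> x = b}"
    unfolding F_def by (intro hull_minimal convex_hyperplane) auto
  moreover have "F \<subseteq> convex hull V"
    unfolding F_def by (intro hull_mono) auto
  ultimately show "F \<subseteq> convex hull V \<inter> {x. a \<bullet> x = b}"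
    by simp
  have "convex ({x. b < a \<bullet> x} \<union> F)"
  proof (rule convexI)
    fix x y and s t :: real
    assume x: "x \<in> {x. b < a \<bullet> x} \<union> F" and y: "y \<in> {x. b < a \<bullet> x} \<union> F"
      and st: "0 \<le> s" "0 \<le> t" "s + t = 1"
    show "s *\<^sub>R x + t *\<^sub>R y \<in> {x. b < a \<bullet> x} \<union> F"
    proof (cases "s = 0 \<or> t = 0 \<or> x \<in> F \<and> y \<in> F")
      case True
      moreover have "convex F"
        by (simp add: F_def)
      ultimately show ?thesis
        using x y st by (auto simp: convexD)
    next
      case False
      then have pos: "0 < s" "0 < t" and ge: "0 \<le> a \<bullet> x - b" "0 \<le> a \<bullet> y - b"
        and gt: "0 < a \<bullet> x - b \<or> 0 < a \<bullet> y - b"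
        using st x y F_plane by auto
      have "0 < s * (a \<bullet> x - b) + t * (a \<bullet> y - b)"
        using gt pos ge by (auto intro: add_pos_nonneg add_nonneg_pos)
      also have "\<dots> = a \<bullet> (s *\<^sub>R x + t *\<^sub>R y) - (s + t) * b"
        by (simp add: inner_add_right algebra_simps)
      finally show ?thesis
        using st(3) by simp
    qed
  qed
  moreover have "V \<subseteq> {x. b < a \<bullet> x} \<union> F"
    using assms hull_subset[of "{v \<in> V. a \<bullet> v = b}" convex] by (force simp: F_def)
  ultimately have "convex hull V \<subseteq> {x. b < a \<bullet> x} \<union> F"
    by (rule hull_minimal[rotated])
  then show "convex hull V \<inter> {x. a \<bullet> x = b} \<subseteq> F"
    by auto
qed

lemma convex_hull_supporting_face:
  fixes a :: "'a::euclidean_space"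
  assumes "\<And>v. v \<in> V \<Longrightarrow> b \<le> a \<bullet> v"
  shows "convex hull {v \<in> V. a \<bullet> v = b} face_of convex hull V"
proof -
  have "convex hull V \<subseteq> {x. b \<le> a \<bullet> x}"
    using assms by (intro hull_minimal convex_halfspace_ge) auto
  then have "convex hull V \<inter> {x. a \<bullet> x = b} face_of convex hull V"
    by (intro face_of_Int_supporting_hyperplane_ge) auto
  then show ?thesis
    using convex_hull_Int_supporting_hyperplane[of V b a] assms by simp
qed

text \<open>
  The vector that represents the linear form \<open>D \<bullet>\<^sub>S _\<close> with respect to the Euclidean inner product;
  it translates intersection numbers into the language of supporting hyperplanes.
\<close>

definition inter_dual :: "(real, 'n::finite) cls \<Rightarrow> (real, 'n) cls"
  where "inter_dual D = (fst D, - snd D)"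

lemma inner_inter_dual: "inter_dual D \<bullet> E = D \<bullet>\<^sub>S E"
  by (simp add: inter_dual_def inter_def inner_prod_def inner_vec_def sum_negf)

lemma inter_scaleR_left: "(c *\<^sub>R D) \<bullet>\<^sub>S E = c * (D \<bullet>\<^sub>S E)"
  by (simp add: inter_def algebra_simps sum_distrib_left)

lemma inter_scaleR_right: "E \<bullet>\<^sub>S (c *\<^sub>R D) = c * (E \<bullet>\<^sub>S D)"
  by (metis inter_scaleR_left inter_commute)

lemma inter_sum_left: "finite A \<Longrightarrow> (\<Sum>i\<in>A. g i) \<bullet>\<^sub>S E = (\<Sum>i\<in>A. g i \<bullet>\<^sub>S E)"
  by (induction A rule: finite_induct) (simp_all add: inter_linear)

text \<open>
  The linear form \<open>u i \<bullet>\<^sub>S _\<close> attains its minimum over the vertices only at \<open>c + u i\<close>.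
\<close>

lemma crosspolytope_vertex_extreme:
  fixes c :: "(real, 'n::finite) cls"
  assumes "0 < \<rho>" and u: "\<And>i. i < n \<Longrightarrow> u i \<bullet>\<^sub>S u i = - \<rho>"
    and orth: "\<And>i j. i < n \<Longrightarrow> j < n \<Longrightarrow> i \<noteq> j \<Longrightarrow> u i \<bullet>\<^sub>S u j = 0"
    and i: "i < n"
  shows "(c + u i) extreme_point_of convex hull (\<Union>i<n. {c + u i, c - u i})"
proof -
  define V where "V = (\<Union>i<n. {c + u i, c - u i})"
  define b where "b = u i \<bullet>\<^sub>S c - \<rho>"
  have val: "u i \<bullet>\<^sub>S (c + u j) = (if j = i then b else b + \<rho>)"
    "u i \<bullet>\<^sub>S (c - u j) = (if j = i then b + 2 * \<rho> else b + \<rho>)" if "j < n" for j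
    using u[OF i] orth[OF i that] by (auto simp: inter_linear b_def)
  have face: "convex hull {v \<in> V. inter_dual (u i) \<bullet> v = b} face_of convex hull V"
    using val \<open>0 < \<rho>\<close> by (intro convex_hull_supporting_face) (auto simp: inner_inter_dual V_def)
  have only: "v = c + u i" if v: "v \<in> V" "u i \<bullet>\<^sub>S v = b" for v
  proof -
    obtain j where j: "j < n" "v = c + u j \<or> v = c - u j"
      using v(1) by (auto simp: V_def)
    then show ?thesis
      using v(2) val[OF j(1)] \<open>0 < \<rho>\<close> by (cases "j = i") auto
  qed
  have "c + u i \<in> V" "u i \<bullet>\<^sub>S (c + u i) = b"
    using i val(1)[OF i] by (auto simp: V_def)
  then have "{v \<in> V. inter_dual (u i) \<bullet> v = b} = {c + u i}"
    unfolding inner_inter_dual using only by blast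
  with face have "convex hull {c + u i} face_of convex hull V"
    by simp
  then show ?thesis
    by (simp add: face_of_singleton V_def)
qed

lemma crosspolytope_vertices_extreme:
  fixes c :: "(real, 'n::finite) cls"
  assumes "0 < \<rho>" and u: "\<And>i. i < n \<Longrightarrow> u i \<bullet>\<^sub>S u i = - \<rho>"
    and orth: "\<And>i j. i < n \<Longrightarrow> j < n \<Longrightarrow> i \<noteq> j \<Longrightarrow> u i \<bullet>\<^sub>S u j = 0"
    and i: "i < n"
  shows "(c + u i) extreme_point_of convex hull (\<Union>i<n. {c + u i, c - u i})"
    and "(c - u i) extreme_point_of convex hull (\<Union>i<n. {c + u i, c - u i})"
proof -
  show "(c + u i) extreme_point_of convex hull (\<Union>i<n. {c + u i, c - u i})"
    by (rule crosspolytope_vertex_extreme[OF assms])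
  \<comment> \<open>Replacing the frame by its negative keeps the crosspolytope and exchanges the two vertices.\<close>
  have "(c + - u i) extreme_point_of convex hull (\<Union>i<n. {c + - u i, c - - u i})"
    using assms by (intro crosspolytope_vertex_extreme[of \<rho>]) (simp_all add: inter_linear)
  moreover have "(\<Union>i<n. {c + - u i, c - - u i}) = (\<Union>i<n. {c + u i, c - u i})"
    by auto
  ultimately show "(c - u i) extreme_point_of convex hull (\<Union>i<n. {c + u i, c - u i})"
    by simp
qed

text \<open>
  Orthogonal vectors of non-zero square are linearly independent, also for an indefinite form, and
  the centre lies in the affine hull.
\<close>

lemma crosspolytope_aff_dim:
  fixes P :: "(real, 'n::finite) cls set"
  assumes "crosspolytope n P" and "0 < n"
  shows "int n \<le> aff_dim P"
proof -
  obtain c u \<rho> where "0 < \<rho>"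
    and u: "\<forall>i<n. - (u i \<bullet>\<^sub>S u i) = \<rho>"
    and orth: "\<forall>i<n. \<forall>j<n. i \<noteq> j \<longrightarrow> u i \<bullet>\<^sub>S u j = 0"
    and P: "P = convex hull (\<Union>i<n. {c + u i, c - u i})"
    using assms(1) unfolding crosspolytope_def by blast
  define V where "V = (\<Union>i<n. {c + u i, c - u i})"
  have inj: "inj_on u {..<n}"
  proof (rule inj_onI, rule ccontr)
    fix i j
    assume "i \<in> {..<n}" "j \<in> {..<n}" "u i = u j" "i \<noteq> j"
    then have "- (u i \<bullet>\<^sub>S u i) = \<rho>" "u i \<bullet>\<^sub>S u i = 0"
      using u orth by (blast, metis lessThan_iff)
    then show False
      using \<open>0 < \<rho>\<close> by linarith
  qed
  have indep: "independent (u ` {..<n})"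
  proof (rule independent_if_scalars_zero)
    fix g and v
    assume zero: "(\<Sum>v\<in>u ` {..<n}. g v *\<^sub>R v) = 0" and "v \<in> u ` {..<n}"
    then obtain i where i: "i < n" "v = u i"
      by auto
    have "0 = (\<Sum>j<n. g (u j) *\<^sub>R u j) \<bullet>\<^sub>S u i"
      using zero by (simp add: sum.reindex[OF inj] inter_linear)
    also have "\<dots> = (\<Sum>j<n. g (u j) * (u j \<bullet>\<^sub>S u i))"
      by (simp add: inter_sum_left inter_scaleR_left)
    also have "\<dots> = (\<Sum>j<n. if j = i then - \<rho> * g v else 0)"
    proof (rule sum.cong)
      fix j
      assume "j \<in> {..<n}"
      then show "g (u j) * (u j \<bullet>\<^sub>S u i) = (if j = i then - \<rho> * g v else 0)"
        using i u[rule_format, of i] orth[rule_format, of j i] by (cases "j = i") auto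
    qed simp
    also have "\<dots> = - \<rho> * g v"
      using i by simp
    finally show "g v = 0"
      using \<open>0 < \<rho>\<close> by simp
  qed simp
  have mid: "c \<in> affine hull V"
  proof -
    have "(1 / 2) *\<^sub>R (c + u 0) + (1 / 2) *\<^sub>R (c - u 0) \<in> affine hull V"
      using \<open>0 < n\<close> by (intro mem_affine affine_affine_hull hull_inc) (auto simp: V_def)
    also have "(1 / 2) *\<^sub>R (c + u 0) + (1 / 2) *\<^sub>R (c - u 0) = (1 / 2) *\<^sub>R (c + c)"
      by (simp add: scaleR_add_right scaleR_diff_right)
    finally show ?thesis
      by (simp only: scaleR_half_double)
  qed
  have "u ` {..<n} \<subseteq> (\<lambda>x. x - c) ` V"
    by (auto simp: V_def image_iff intro!: bexI)
  then have "card (u ` {..<n}) \<le> dim ((\<lambda>x. x - c) ` V)"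
    using indep by (intro independent_card_le_dim)
  then show ?thesis
    using inj by (simp add: P aff_dim_convex_hull V_def[symmetric] aff_dim_eq_dim_subtract[OF mid] card_image)
qed

section \<open>Crosspolytope facets of the Gosset polytope\<close>

lemma real_cls_add: "real_cls (D + E) = real_cls D + real_cls E"
  and real_cls_diff: "real_cls (D - E) = real_cls D - real_cls E"
  by (simp_all add: real_cls_def vec_eq_iff)

lemma real_cls_inter: "real_cls D \<bullet>\<^sub>S real_cls E = of_int (D \<bullet>\<^sub>S E)"
  by (simp add: real_cls_def inter_def)

lemma real_cls_inject: "real_cls D = real_cls E \<longleftrightarrow> D = E"
  by (simp add: real_cls_def vec_eq_iff prod_eq_iff)

lemma gosset_hyperplane:
  assumes "x \<in> (gosset_polytope :: (real, 'n::finite) cls set)"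
  shows "real_cls (K_cls :: 'n pic) \<bullet>\<^sub>S x = - 1"
proof -
  have "gosset_polytope \<subseteq> {x. inter_dual (real_cls (K_cls :: 'n pic)) \<bullet> x = - 1}"
    unfolding gosset_polytope_def
    by (intro hull_minimal convex_hyperplane)
       (auto simp: inner_inter_dual real_cls_inter inter_commute[of K_cls "_ :: 'n pic"] lines_iff)
  then show ?thesis
    using assms by (auto simp: inner_inter_dual)
qed

lemma gosset_aff_dim_le: "aff_dim (gosset_polytope :: (real, 'n::finite) cls set) \<le> int CARD('n)"
proof -
  define k where "k = inter_dual (real_cls (K_cls :: 'n pic))"
  have "real_cls (K_cls :: 'n pic) \<bullet>\<^sub>S real_cls h_cls = - 3"
    by (simp add: real_cls_inter inter_commute[of K_cls h_cls] inter_h_K)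
  then have "k \<bullet> real_cls h_cls \<noteq> 0"
    by (simp add: k_def inner_inter_dual)
  then have "k \<noteq> 0"
    by auto
  then have "aff_dim {x. k \<bullet> x = - 1} = int CARD('n)"
    by (simp add: aff_dim_hyperplane)
  moreover have "gosset_polytope \<subseteq> {x. k \<bullet> x = - 1}"
    by (auto simp: k_def inner_inter_dual gosset_hyperplane)
  ultimately show ?thesis
    by (metis aff_dim_subset)
qed

text \<open>
  The face that corresponds to a ruling is spanned by the components of its reducible fibres.
\<close>

definition ruling_face :: "'n::finite pic \<Rightarrow> (real, 'n) cls set"
  where "ruling_face f = convex hull (real_cls ` {l \<in> lines. l \<bullet>\<^sub>S f = 0})"

text \<open>
  Nefness of \<open>f\<close> says that \<open>x \<bullet>\<^sub>S f = 0\<close> is a supporting hyperplane.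
\<close>

lemma ruling_face_face:
  fixes f :: "'n::finite pic"
  assumes "CARD('n) \<le> 8" and "f \<in> rulings"
  shows "ruling_face f face_of gosset_polytope"
proof -
  define a where "a = inter_dual (real_cls f)"
  have a: "a \<bullet> real_cls l = of_int (l \<bullet>\<^sub>S f)" for l
    by (simp add: a_def inner_inter_dual real_cls_inter inter_commute[of f l])
  have "convex hull {v \<in> real_cls ` lines. a \<bullet> v = 0} face_of gosset_polytope"
    unfolding gosset_polytope_def
    using line_inter_ruling_nonneg[OF assms(1) _ assms(2)]
    by (intro convex_hull_supporting_face) (auto simp: a)
  moreover have "{v \<in> real_cls ` lines. a \<bullet> v = 0} = real_cls ` {l \<in> lines. l \<bullet>\<^sub>S f = 0}"
    by (auto simp: a)
  ultimately show ?thesis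
    by (simp add: ruling_face_def)
qed

lemma line_in_ruling_face:
  assumes "real_cls l \<in> ruling_face f"
  shows "l \<bullet>\<^sub>S f = 0"
proof -
  have "ruling_face f \<subseteq> {x. inter_dual (real_cls f) \<bullet> x = 0}"
    unfolding ruling_face_def
    by (intro hull_minimal convex_hyperplane)
       (auto simp: inner_inter_dual real_cls_inter inter_commute[of f "_ :: 'a pic"])
  then have "real_cls f \<bullet>\<^sub>S real_cls l = 0"
    using assms by (auto simp: inner_inter_dual)
  then show ?thesis
    by (simp add: real_cls_inter inter_commute[of f l])
qed

text \<open>
  The two components of each reducible fibre add up to \<open>f\<close>, so they are antipodal with respect to
  \<open>f / 2\<close>. Because \<open>f\<close> is isotropic and orthogonal to all components, translating by \<open>f / 2\<close> does
  not change their intersection numbers: the \<open>L i - f / 2\<close> are an orthogonal frame of square \<open>- 1\<close>.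
\<close>

lemma ruling_face_crosspolytope:
  fixes f :: "'n::finite pic"
  assumes f: "f \<in> rulings" and L: "reducible_fibres f L"
  shows "crosspolytope (CARD('n) - 1) (ruling_face f)"
proof -
  define c where "c = (1 / 2) *\<^sub>R real_cls f"
  define u where "u i = real_cls (L i) - c" for i
  have L': "L i \<in> lines" "L i \<bullet>\<^sub>S f = 0" "f \<bullet>\<^sub>S L i = 0" if "i < CARD('n) - 1" for i
    using L that by (auto simp: reducible_fibres_def inter_commute[of f "L i"])
  have ff: "f \<bullet>\<^sub>S f = 0"
    using f by (simp add: rulings_iff)
  have uu: "u i \<bullet>\<^sub>S u j = of_int (L i \<bullet>\<^sub>S L j)" if "i < CARD('n) - 1" "j < CARD('n) - 1" for i j
    using L'[OF that(1)] L'[OF that(2)] ff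
    by (simp add: u_def c_def inter_linear inter_scaleR_left inter_scaleR_right real_cls_inter)
  have norm: "- (u i \<bullet>\<^sub>S u i) = 1" if "i < CARD('n) - 1" for i
    using L'(1)[OF that] uu[OF that that] by (simp add: lines_iff)
  have orth: "u i \<bullet>\<^sub>S u j = 0" if "i < CARD('n) - 1" "j < CARD('n) - 1" "i \<noteq> j" for i j
    using L that uu[OF that(1,2)] by (simp add: reducible_fibres_def)
  have cc: "c + c = real_cls f"
    unfolding c_def by (simp flip: scaleR_add_left)
  have vertices: "c + u i = real_cls (L i)" "c - u i = real_cls (f - L i)" for i
    by (simp_all add: u_def real_cls_diff flip: cc)
  have "{l \<in> lines. l \<bullet>\<^sub>S f = 0} = (\<Union>i<CARD('n) - 1. {L i, f - L i})"
  proof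
    show "{l \<in> lines. l \<bullet>\<^sub>S f = 0} \<subseteq> (\<Union>i<CARD('n) - 1. {L i, f - L i})"
      using L unfolding reducible_fibres_def by blast
    show "(\<Union>i<CARD('n) - 1. {L i, f - L i}) \<subseteq> {l \<in> lines. l \<bullet>\<^sub>S f = 0}"
      using L' residual_line(1,2)[OF L'(1) f L'(2)] by blast
  qed
  then have "real_cls ` {l \<in> lines. l \<bullet>\<^sub>S f = 0} = (\<Union>i<CARD('n) - 1. {c + u i, c - u i})"
    by (simp add: vertices image_UN)
  then have "ruling_face f = convex hull (\<Union>i<CARD('n) - 1. {c + u i, c - u i})"
    by (simp add: ruling_face_def)
  then show ?thesis
    unfolding crosspolytope_def using norm orth zero_less_one[where 'a = real] by blast
qed

text \<open>
  The Gosset polytope lies in the hyperplane of degree 1, of dimension \<open>r\<close>, and the face contains a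
  frame of \<open>r - 1\<close> directions. A face strictly inside the polytope therefore has dimension exactly
  \<open>r - 1\<close>, and it is strictly inside because \<open>f\<close> cannot be orthogonal to all the \<open>e\<^sub>i\<close>: its degree
  would be \<open>2 / 3\<close>.
\<close>

lemma ruling_face_crosspolytope_facet:
  fixes f :: "'n::finite pic"
  assumes r: "3 \<le> CARD('n)" "CARD('n) \<le> 8" and f: "f \<in> rulings" and L: "reducible_fibres f L"
  shows "ruling_face f \<in> crosspolytope_facets"
proof -
  have cross: "crosspolytope (CARD('n) - 1) (ruling_face f)"
    by (rule ruling_face_crosspolytope[OF f L])
  have "int (CARD('n) - 1) \<le> aff_dim (ruling_face f)"
    using r by (intro crosspolytope_aff_dim[OF cross]) simp
  moreover have "ruling_face f \<noteq> gosset_polytope"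
  proof
    assume eq: "ruling_face f = gosset_polytope"
    have zero: "snd f $ i = 0" for i
    proof -
      have "real_cls (e_cls i) \<in> ruling_face f"
        unfolding eq gosset_polytope_def by (intro hull_inc imageI e_cls_line)
      then show ?thesis
        using line_in_ruling_face[of "e_cls i" f] by (simp add: inter_e)
    qed
    have "f \<bullet>\<^sub>S K_cls = - 2"
      using f by (simp add: rulings_iff)
    then show False
      unfolding inter_K by (simp add: zero) presburger
  qed
  then have "aff_dim (ruling_face f) < aff_dim (gosset_polytope :: (real, 'n) cls set)"
    using ruling_face_face[OF r(2) f]
    by (intro face_of_aff_dim_lt) (simp_all add: gosset_polytope_def)
  moreover have "aff_dim (gosset_polytope :: (real, 'n) cls set) \<le> int CARD('n)"
    by (rule gosset_aff_dim_le)
  ultimately show ?thesis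
    using ruling_face_face[OF r(2) f] r cross
    by (auto simp: crosspolytope_facets_def facet_of_def)
qed

lemma facet_subset_facet_eq:
  fixes S :: "'a::euclidean_space set"
  assumes "F facet_of S" and "G facet_of S" and "F \<subseteq> G"
  shows "F = G"
proof (rule ccontr)
  assume "F \<noteq> G"
  have "F face_of G"
    using assms by (meson face_of_face facet_of_imp_face_of)
  then have "aff_dim F < aff_dim G"
    using \<open>F \<noteq> G\<close> assms(2) by (intro face_of_aff_dim_lt)
      (auto intro: face_of_imp_convex facet_of_imp_face_of)
  then show False
    using assms(1,2) by (simp add: facet_of_def)
qed

text \<open>
  For \<open>r = 8\<close> the involution \<open>l \<mapsto> - 2 K - l\<close> (induced by the Bertini involution) permutes the lines,
  so the polytope is centrally symmetric about \<open>- K\<close>. A face through the centre contains both ends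
  of every segment between opposite vertices, hence is the whole polytope.
\<close>

lemma no_facet_contains_minus_K:
  fixes P :: "(real, 'n::finite) cls set"
  assumes "CARD('n) = 8" and "P facet_of gosset_polytope"
    and "c + c = real_cls (scale_cls (- 2) K_cls)" 
  shows "c \<notin> P"
proof
  assume "c \<in> P"
  define f where "f = (scale_cls (- 2) K_cls :: 'n pic)"
  have face: "P face_of gosset_polytope"
    by (rule facet_of_imp_face_of[OF assms(2)])
  have KK: "(K_cls :: 'n pic) \<bullet>\<^sub>S K_cls = 1"
    by (simp add: inter_K_K assms(1))
  have "real_cls l \<in> P" if l: "l \<in> lines" for l
  proof -
    have "f - l \<in> lines" and neq: "l \<noteq> f - l"
    proof -
      have ll: "l \<bullet>\<^sub>S l = - 1" "l \<bullet>\<^sub>S K_cls = - 1" "K_cls \<bullet>\<^sub>S l = - 1"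
        using l by (simp_all add: lines_iff inter_commute[of K_cls l])
      then show "f - l \<in> lines"
        by (simp add: lines_iff f_def inter_linear KK)
      have "(f - l) \<bullet>\<^sub>S l = 3"
        by (simp add: f_def inter_linear ll)
      then show "l \<noteq> f - l"
        using ll(1) by auto
    qed
    have "midpoint (real_cls l) (real_cls (f - l)) = (1 / 2) *\<^sub>R (c + c)"
      using assms(3) by (simp add: midpoint_def real_cls_diff f_def)
    then have "c = midpoint (real_cls l) (real_cls (f - l))"
      by (simp only: scaleR_half_double)
    then have "c \<in> open_segment (real_cls l) (real_cls (f - l))"
      using neq by (simp add: real_cls_inject)
    moreover have "real_cls l \<in> gosset_polytope" "real_cls (f - l) \<in> gosset_polytope"
      using l \<open>f - l \<in> lines\<close> by (auto simp: gosset_polytope_def intro: hull_inc)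
    ultimately show ?thesis
      using face_ofD[OF face] \<open>c \<in> P\<close> by blast
  qed
  then have "gosset_polytope \<subseteq> P"
    unfolding gosset_polytope_def
    by (intro hull_minimal) (auto intro: face_of_imp_convex[OF face])
  then have "P = gosset_polytope"
    using face_of_imp_subset[OF face] by auto
  then show False
    using assms(2) by simp
qed

text \<open>
  The vertices of the facet are extreme points of the Gosset polytope, hence lines, and antipodal
  ones add up to the same class \<open>f\<close>, twice the centre. Let \<open>m\<close> be the intersection number of an
  antipodal pair. Orthogonality of the frame shows that non-antipodal vertices meet in
  \<open>(m - 1) / 2\<close>, so \<open>m\<close> is odd, and the Hodge index inequality for \<open>f\<close> gives
  \<open>(9 - r) (2 m - 2) \<le> 4\<close>. Either \<open>m = 1\<close>, where \<open>f\<close> is a ruling orthogonal to all vertices, so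
  that the facet lies in, and hence is, the facet of \<open>f\<close>; or \<open>r = 8\<close>, \<open>m = 3\<close> and \<open>f = - 2 K\<close>,
  where the centre of the facet would be the centre of the whole polytope.
\<close>

lemma crosspolytope_facet_is_ruling_face:
  fixes P :: "(real, 'n::finite) cls set" and p :: "nat \<Rightarrow> 'n"
  assumes r: "3 \<le> CARD('n)" "CARD('n) \<le> 8" and p: "bij_betw p {1..CARD('n)} UNIV"
    and P: "P \<in> crosspolytope_facets"
  shows "\<exists>f\<in>rulings. P = ruling_face f"
proof -
  define n where "n = CARD('n) - 1"
  have n: "0 < n" "1 < n"
    using r by (simp_all add: n_def)
  have facet: "P facet_of gosset_polytope" and "crosspolytope n P"
    using P by (simp_all add: crosspolytope_facets_def n_def)
  then obtain c u \<rho> where "0 < \<rho>"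
    and radius: "\<forall>i<n. - (u i \<bullet>\<^sub>S u i) = \<rho>"
    and orth: "\<And>i j. i < n \<Longrightarrow> j < n \<Longrightarrow> i \<noteq> j \<Longrightarrow> u i \<bullet>\<^sub>S u j = 0"
    and P_eq: "P = convex hull (\<Union>i<n. {c + u i, c - u i})"
    unfolding crosspolytope_def by blast
  have uu: "u i \<bullet>\<^sub>S u i = - \<rho>" if "i < n" for i
  proof -
    have "- (u i \<bullet>\<^sub>S u i) = \<rho>"
      using radius that by blast
    then show ?thesis
      by linarith
  qed
  have face: "P face_of gosset_polytope"
    by (rule facet_of_imp_face_of[OF facet])
  have vertex_line: "\<exists>l\<in>lines. real_cls l = x" if "x extreme_point_of P" for x
  proof -
    have "x extreme_point_of gosset_polytope"
      using that face by (meson face_of_singleton face_of_trans)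
    then show ?thesis
      unfolding gosset_polytope_def by (auto dest: extreme_point_of_convex_hull)
  qed
  have "(c + u i) extreme_point_of P" "(c - u i) extreme_point_of P" if "i < n" for i
    unfolding P_eq
    by (rule crosspolytope_vertices_extreme[of \<rho> n u i c]; use \<open>0 < \<rho>\<close> uu orth that in blast)+
  then have "\<exists>l\<in>lines. real_cls l = c + u i" "\<exists>l\<in>lines. real_cls l = c - u i" if "i < n" for i
    using vertex_line that by blast+
  then obtain L L' where L: "\<And>i. i < n \<Longrightarrow> L i \<in> lines" "\<And>i. i < n \<Longrightarrow> real_cls (L i) = c + u i"
    and L': "\<And>i. i < n \<Longrightarrow> L' i \<in> lines" "\<And>i. i < n \<Longrightarrow> real_cls (L' i) = c - u i"
    by metis
  define f m where "f = L 0 + L' 0" and "m = L 0 \<bullet>\<^sub>S L' 0"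
  have f_real: "real_cls f = c + c"
    using L(2) L'(2) n by (simp add: f_def real_cls_add)
  have L0: "L 0 \<bullet>\<^sub>S L 0 = - 1" "L 0 \<bullet>\<^sub>S K_cls = - 1" and L'0: "L' 0 \<bullet>\<^sub>S L' 0 = - 1" "L' 0 \<bullet>\<^sub>S K_cls = - 1"
    using L(1) L'(1) n by (simp_all add: lines_iff)
  have f_K: "f \<bullet>\<^sub>S K_cls = - 2"
    by (simp add: f_def inter_linear L0 L'0)
  have f_f: "f \<bullet>\<^sub>S f = 2 * m - 2"
    by (simp add: f_def inter_linear L0 L'0 m_def inter_commute[of "L' 0" "L 0"])
  have cu: "c \<bullet>\<^sub>S u i = 0" and cc: "c \<bullet>\<^sub>S c = \<rho> - 1" if "i < n" for i
  proof -
    have "(c + u i) \<bullet>\<^sub>S (c + u i) = - 1" "(c - u i) \<bullet>\<^sub>S (c - u i) = - 1"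
      using L(1)[OF that] L'(1)[OF that]
      by (simp_all add: real_cls_inter lines_iff flip: L(2)[OF that] L'(2)[OF that])
    then have "c \<bullet>\<^sub>S c + 2 * (c \<bullet>\<^sub>S u i) - \<rho> = - 1" "c \<bullet>\<^sub>S c - 2 * (c \<bullet>\<^sub>S u i) - \<rho> = - 1"
      using uu[OF that] by (simp_all add: inter_linear inter_commute[of "u i" c])
    then show "c \<bullet>\<^sub>S u i = 0" "c \<bullet>\<^sub>S c = \<rho> - 1"
      by linarith+
  qed
  have "real_of_int (f \<bullet>\<^sub>S f) = 4 * (c \<bullet>\<^sub>S c)"
    by (simp add: f_real inter_linear flip: real_cls_inter)
  then have \<rho>: "2 * \<rho> = of_int m + 1"
    using f_f cc[OF n(1)] by simp
  have "real_of_int (L 0 \<bullet>\<^sub>S L 1) = (c + u 0) \<bullet>\<^sub>S (c + u 1)"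
    using L(2) n by (simp flip: real_cls_inter)
  also have "\<dots> = \<rho> - 1"
    using cu[OF n(1)] cu[OF n(2)] cc[OF n(1)] orth[OF n(1) n(2)]
    by (simp add: inter_linear inter_commute[of "u 0" c])
  finally have "real_of_int (2 * (L 0 \<bullet>\<^sub>S L 1)) = of_int (m - 1)"
    using \<rho> by simp
  then have odd: "2 * (L 0 \<bullet>\<^sub>S L 1) = m - 1"
    by (simp only: of_int_eq_iff)
  have "0 \<le> m"
    using \<rho> \<open>0 < \<rho>\<close> by linarith
  have hodge: "(9 - int CARD('n)) * (2 * m - 2) \<le> 4"
    using hodge_index[OF r(2), of f] by (simp add: f_f f_K)
  have "m = 1 \<or> m \<ge> 3"
    using odd \<open>0 \<le> m\<close> by presburger
  then show ?thesis
  proof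
    assume m: "m = 1"
    then have f: "f \<in> rulings"
      by (simp add: rulings_iff f_f f_K)
    have "c \<bullet>\<^sub>S c = 0"
      using m \<rho> cc[OF n(1)] by simp
    have L_f: "L i \<bullet>\<^sub>S f = 0" "L' i \<bullet>\<^sub>S f = 0" if i: "i < n" for i
    proof -
      have "real_of_int (L i \<bullet>\<^sub>S f) = (c + u i) \<bullet>\<^sub>S (c + c)" "real_of_int (L' i \<bullet>\<^sub>S f) = (c - u i) \<bullet>\<^sub>S (c + c)"
        using L(2)[OF i] L'(2)[OF i] f_real by (simp_all flip: real_cls_inter)
      then show "L i \<bullet>\<^sub>S f = 0" "L' i \<bullet>\<^sub>S f = 0"
        using \<open>c \<bullet>\<^sub>S c = 0\<close> cu[OF i] by (simp_all add: inter_linear inter_commute[of "u i" c])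
    qed
    have "{c + u i, c - u i} \<subseteq> real_cls ` {l \<in> lines. l \<bullet>\<^sub>S f = 0}" if i: "i < n" for i
      using L[OF i] L'[OF i] L_f[OF i] by (auto simp flip: L(2)[OF i] L'(2)[OF i])
    then have "P \<subseteq> ruling_face f"
      unfolding P_eq ruling_face_def by (intro hull_mono) blast
    moreover obtain M where "reducible_fibres f M"
      using ruling_has_reducible_fibres[OF r p f] by blast
    then have "ruling_face f facet_of gosset_polytope"
      using ruling_face_crosspolytope_facet[OF r f] by (simp add: crosspolytope_facets_def)
    ultimately show ?thesis
      using facet_subset_facet_eq[OF facet] f by blast
  next
    assume m: "3 \<le> m"
    have "(9 - int CARD('n)) * 4 \<le> (9 - int CARD('n)) * (2 * m - 2)"
      using m r by (intro mult_left_mono) auto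
    also note hodge
    finally have "8 \<le> CARD('n)"
      by simp
    then have card: "CARD('n) = 8"
      using r(2) by simp
    then have "m = 3"
      using hodge m by simp
    have "(K_cls :: 'n pic) \<bullet>\<^sub>S K_cls = 1"
      by (simp add: inter_K_K card)
    then have "f + scale_cls 2 K_cls = 0"
      using \<open>m = 3\<close>
      by (intro K_orthogonal_negative_definite[OF r(2)])
         (simp_all add: inter_linear f_K f_f inter_commute[of K_cls f])
    then have "f = scale_cls (- 2) K_cls"
      by (simp add: scale_cls_def prod_eq_iff vec_eq_iff add_eq_0_iff)
    moreover have "c \<in> P"
    proof -
      have "c + u 0 \<in> P" "c - u 0 \<in> P"
        unfolding P_eq using n(1) by (auto intro!: hull_inc bexI[of _ 0])
      then have "midpoint (c + u 0) (c - u 0) \<in> P"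
        using closed_segment_subset[OF _ _ face_of_imp_convex[OF face]] midpoint_in_closed_segment by blast
      moreover have "midpoint (c + u 0) (c - u 0) = (1 / 2) *\<^sub>R (c + c)"
        by (simp add: midpoint_def)
      ultimately show ?thesis
        by (simp only: scaleR_half_double)
    qed
    ultimately show ?thesis
      using no_facet_contains_minus_K[OF card facet, of c] f_real by simp
  qed
qed

theorem theorem13:
  fixes r :: nat and p :: "nat \<Rightarrow> 'n::finite"
  assumes "3 \<le> r" and "r \<le> 8"
    and "bij_betw p {1..r} (UNIV :: 'n set)"
  shows "(\<forall>f\<in>(rulings :: 'n pic set). \<exists>l1\<in>lines. \<exists>l2\<in>lines. l1 \<bullet>\<^sub>S l2 = 1 \<and> f = l1 + l2)
    \<and> (\<exists>g. bij_betw g (rulings :: 'n pic set) (crosspolytope_facets :: (real, 'n) cls set set))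
    \<and> transitive_action (weyl_group p) (rulings :: 'n pic set) (\<lambda>w. restrict w rulings)"
proof -
  have "r = CARD('n)"
    using bij_betw_same_card[OF assms(3)] by simp
  then have r: "3 \<le> CARD('n)" "CARD('n) \<le> 8" and p: "bij_betw p {1..CARD('n)} UNIV"
    using assms by simp_all
  have fibre: "\<exists>l\<in>lines. l \<bullet>\<^sub>S f = 0" if "f \<in> rulings" for f :: "'n pic"
  proof -
    obtain L where "reducible_fibres f L"
      using ruling_has_reducible_fibres[OF r p \<open>f \<in> rulings\<close>] by blast
    moreover have "0 < CARD('n) - 1"
      using r by simp
    ultimately show ?thesis
      unfolding reducible_fibres_def by blast
  qed
  have decomposition: "\<exists>l1\<in>lines. \<exists>l2\<in>lines. l1 \<bullet>\<^sub>S l2 = 1 \<and> f = l1 + l2" if f: "f \<in> rulings" for f :: "'n pic"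
  proof -
    obtain l where l: "l \<in> lines" "l \<bullet>\<^sub>S f = 0"
      using fibre[OF f] by blast
    show ?thesis
      using l(1) residual_line[OF l(1) f l(2)] by (intro bexI[of _ l] bexI[of _ "f - l"]) auto
  qed
  have "bij_betw ruling_face (rulings :: 'n pic set) crosspolytope_facets"
  proof (rule bij_betw_imageI)
    show "inj_on ruling_face (rulings :: 'n pic set)"
    proof (rule inj_onI)
      fix f g :: "'n pic"
      assume f: "f \<in> rulings" and g: "g \<in> rulings" and eq: "ruling_face f = ruling_face g"
      have orth: "l \<bullet>\<^sub>S g = 0" if "l \<in> lines" "l \<bullet>\<^sub>S f = 0" for l
      proof (rule line_in_ruling_face)
        have "real_cls l \<in> ruling_face f"
          unfolding ruling_face_def using that by (intro hull_inc) auto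
        then show "real_cls l \<in> ruling_face g"
          by (simp add: eq)
      qed
      obtain l where l: "l \<in> lines" "l \<bullet>\<^sub>S f = 0"
        using fibre[OF f] by blast
      have "l \<bullet>\<^sub>S g = 0" "(f - l) \<bullet>\<^sub>S g = 0"
        using orth l residual_line[OF l(1) f l(2)] by blast+
      then have "f \<bullet>\<^sub>S g = 0"
        by (simp add: inter_linear)
      then show "f = g"
        by (rule rulings_orthogonal_imp_eq[OF r(2) f g])
    qed
    show "ruling_face ` rulings = (crosspolytope_facets :: (real, 'n) cls set set)"
      using ruling_has_reducible_fibres[OF r p] ruling_face_crosspolytope_facet[OF r]
        crosspolytope_facet_is_ruling_face[OF r p]
      by blast
  qed
  then show ?thesis
    using decomposition weyl_group_transitive[OF r p] by blast
qed

end
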